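(* Let $r\ge 1$ be an integer and suppose that $A\subseteq\mathbb{F}_2^r$ is round. If $|A|>\frac{11}{36}\,2^r+3$, then there are a sum-free set $S\subseteq\mathbb{F}_2^r$ and an element $g\in\mathbb{F}_2^r$ such that $A=g+(S\cup\{0\})$.
   Context: $\mathbb{F}_2^r$ denotes the elementary abelian $2$-group of rank $r$. For $X\subseteq\mathbb{F}_2^r$, $2X:=\{x_1+x_2\colon x_1,x_2\in X\}$ (with $x_1=x_2$ allowed), and $g+X:=\{g+x\colon x\in X\}$. A set $A\subseteq\mathbb{F}_2^r$ is round if $2B\ne 2A$ for every proper subset $B\subsetneq A$. A set $S$ is sum-free if $S\cap 2S=\varnothing$. *)

theory Defs
  imports
    "HOL-Analysis.Finite_Cartesian_Product"
    "HOL-Library.Set_Algebras"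
    "HOL-Library.Z2"
begin

text \<open>The sumset $2X$ is \<open>X + X\<close> and the translate $g + X$ is \<open>g +o X\<close>.
  The group $\mathbb{F}_2^r$ is \<open>bit ^ 'r\<close> with $r = $ \<open>CARD('r)\<close>, which is automatically
  at least 1.\<close>

instance bit :: finite
proof
  have "(UNIV :: bit set) = {0, 1}"
    by (auto intro: bit.exhaust)
  then show "finite (UNIV :: bit set)"
    by (metis finite.simps)
qed

definition round_set :: "'a::plus set \<Rightarrow> bool" where
  "round_set A \<longleftrightarrow> (\<forall>B. B \<subset> A \<longrightarrow> B + B \<noteq> A + A)"

definition sum_free :: "'a::plus set \<Rightarrow> bool" where
  "sum_free S \<longleftrightarrow> S \<inter> (S + S) = {}"

end

theory Submission
  imports Defs
begin

text \<open>
  Call \<open>a, b \<in> A\<close> adjacent if \<open>a + b\<close> has no other representation as a sum of two elements of \<open>A\<close>.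
  Roundness says that no vertex of this graph is isolated, and the conclusion says that some vertex
  is adjacent to all the others.  Write \<open>n\<close> for the order of the group, \<open>U\<close> for the set of uniquely
  represented sums, \<open>\<alpha> = |A|\<close> and \<open>w = |U|\<close>.

  For an edge \<open>ab\<close> the sets \<open>A\<close>, \<open>a + b + A\<close>, \<open>a + U\<close>, \<open>b + U\<close> are almost disjoint, whence
  \<open>\<alpha> + w \<le> n/2 + deg a + deg b\<close>.  As \<open>\<alpha>\<close> is the sum of \<open>1/deg a + 1/deg b\<close> over all edges, this
  leaves only two possibilities: \<open>w \<ge> \<alpha> - 2\<close> or \<open>w \<le> n/2 - \<alpha> + 2\<close>.

  In the first one there are no three disjoint edges, so two vertices dominate the graph.  If no
  vertex is adjacent to all the others, the neighbourhoods of these two yield disjoint sets \<open>B, C\<close>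
  such that \<open>B + C\<close> avoids \<open>B \<union> C\<close>, and these are too large to coexist.

  In the second one let \<open>f(x) = |A \<inter> (A + x)|\<close> and \<open>h(x) = |U \<inter> (U + x)|\<close> for a sum \<open>x\<close> of two distinct
  elements of \<open>U\<close>, and put \<open>\<mu> = 2\<alpha> - n/2\<close>.  Up to small errors \<open>f(x) \<ge> h(x) + \<mu>\<close> (count in the cosets
  of the four-element group generated by the two summands) and \<open>f(x) + h(x) \<le> w\<close> (the set
  \<open>A \<inter> (A + x)\<close> contains no edge), so that \<open>(w + \<mu>) h(x) \<le> (w - \<mu>) f(x)\<close>.  Summing over \<open>x\<close> contradicts
  \<open>\<Sum> f(x) \<le> \<alpha>\<^sup>2 - \<alpha>\<close> and \<open>\<Sum> h(x) = w\<^sup>2 - w\<close>.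
\<close>

section \<open>Groups of exponent two\<close>

class boolean_group = ab_group_add +
  assumes add_self [simp]: "x + x = 0"
begin

lemma add_self_left [simp]: "x + (x + y) = y"
  by (simp flip: add.assoc)

lemma add_eq_0_iff_eq [simp]: "x + y = 0 \<longleftrightarrow> x = y"
  by (metis add_self add_left_cancel)

end

instance bit :: boolean_group
proof
  show "x + x = 0" for x :: bit
    by (cases x) auto
qed

instance vec :: (boolean_group, finite) boolean_group
  by standard (simp add: vec_eq_iff)

lemma card_translate: "card ((+) t ` S) = card S"
  for S :: "'a::cancel_semigroup_add set"
  by (simp add: card_image)

lemma in_translate_iff: "x \<in> (+) t ` S \<longleftrightarrow> t + x \<in> S"
  for S :: "'a::boolean_group set"
  by (auto intro: image_eqI[of _ _ "t + x"])

lemma set_plus_Int_empty_iff: "(S + T) \<inter> Z = {} \<longleftrightarrow> (\<forall>s\<in>S. \<forall>t\<in>T. s + t \<notin> Z)"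
  by (auto simp: set_plus_def)

lemma two_mult_card_subgroup_le:
  fixes K :: "'a::{boolean_group, finite} set"
  assumes "K + K \<subseteq> K" and "c \<notin> K"
  shows "2 * card K \<le> CARD('a)"
proof -
  have "c + x \<notin> K" if "x \<in> K" for x
    using assms that set_plus_intro[of "c + x" K x K] by (auto simp: ac_simps)
  then have "K \<inter> (+) c ` K = {}" by auto
  then have "2 * card K = card (K \<union> (+) c ` K)"
    by (simp add: card_Un_disjoint card_translate)
  also have "\<dots> \<le> CARD('a)" by (intro card_mono) auto
  finally show ?thesis .
qed

lemma card_translate_add_Diff_le:
  fixes B :: "'a::ab_semigroup_add set"
  assumes "finite B"
  shows "card ((+) (s + t) ` B - B) \<le> card ((+) s ` B - B) + card ((+) t ` B - B)"
proof -
  have "(+) (s + t) ` B = (+) s ` (+) t ` B"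
    by (simp add: image_image add.assoc)
  then have "(+) (s + t) ` B - B \<subseteq> (+) s ` ((+) t ` B - B) \<union> ((+) s ` B - B)"
    by auto
  then have "card ((+) (s + t) ` B - B) \<le> card ((+) s ` ((+) t ` B - B) \<union> ((+) s ` B - B))"
    using assms by (intro card_mono) auto
  also have "\<dots> \<le> card ((+) s ` ((+) t ` B - B)) + card ((+) s ` B - B)"
    by (rule card_Un_le)
  also have "card ((+) s ` ((+) t ` B - B)) \<le> card ((+) t ` B - B)"
    using assms by (intro card_image_le) auto
  finally show ?thesis by simp
qed

lemma almost_closed_imp_triple_sums:
  fixes B :: "'a::boolean_group set"
  assumes "finite B" and almost_closed: "\<And>b. b \<in> B \<Longrightarrow> 3 * card ((+) b ` B - B) < card B"
  shows "B + B + B \<subseteq> B + B"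
proof
  fix x assume "x \<in> B + B + B"
  then obtain b c d where x: "x = b + c + d" and bcd: "b \<in> B" "c \<in> B" "d \<in> B"
    by (auto elim!: set_plus_elim)
  have "card ((+) x ` B - B) \<le> card ((+) b ` B - B) + card ((+) c ` B - B) + card ((+) d ` B - B)"
    unfolding x using card_translate_add_Diff_le[OF \<open>finite B\<close>, of "b + c" d]
      card_translate_add_Diff_le[OF \<open>finite B\<close>, of b c] by linarith
  then have "card ((+) x ` B - B) < card ((+) x ` B)"
    using almost_closed[OF bcd(1)] almost_closed[OF bcd(2)] almost_closed[OF bcd(3)]
    by (simp add: card_translate)
  then have "(+) x ` B - B \<noteq> (+) x ` B" by auto
  then obtain y where "y \<in> B" "x + y \<in> B" by auto
  then have "(x + y) + y \<in> B + B" by (intro set_plus_intro)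
  then show "x \<in> B + B" by (simp add: add.assoc)
qed

lemma triple_sums_imp_subgroup:
  fixes B :: "'a::boolean_group set"
  assumes "B + B + B \<subseteq> B + B"
  shows "(B + B) + (B + B) \<subseteq> B + B" and "B \<subseteq> B + B"
proof -
  have "(B + B) + (B + B) = (B + B + B) + B" by (simp add: add.assoc)
  also have "\<dots> \<subseteq> (B + B) + B" using assms by (rule set_plus_mono2) simp
  finally show "(B + B) + (B + B) \<subseteq> B + B" using assms by simp
  have "x + x + x \<in> B + B" if "x \<in> B" for x
    using that by (intro subsetD[OF assms] set_plus_intro)
  then show "B \<subseteq> B + B" by auto
qed

lemma card_disjoint_from_subgroup_le:
  fixes K B C :: "'a::{boolean_group, finite} set"
  assumes subgroup: "K + K \<subseteq> K" and "B \<subseteq> K" and "K \<inter> C = {}" and "(B + C) \<inter> C = {}"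
  shows "card K * card C \<le> (CARD('a) - card K) * (card K - card B)"
proof -
  have K_add: "x + y \<in> K" if "x \<in> K" "y \<in> K" for x y
    using subgroup that by (auto intro: set_plus_intro)
  have fibre: "card {y \<in> - K. c + y \<in> K} = card K" if "c \<in> C" for c
  proof -
    have "y \<notin> K" if "c + y \<in> K" for y
      using K_add[OF that, of y] \<open>c \<in> C\<close> \<open>K \<inter> C = {}\<close> by (auto simp: add.assoc)
    then have "{y \<in> - K. c + y \<in> K} = (+) c ` K"
      by (auto simp: in_translate_iff)
    then show ?thesis by (simp add: card_translate)
  qed
  have coset: "card {c \<in> C. c + y \<in> K} \<le> card K - card B" for y
  proof (cases "{c \<in> C. c + y \<in> K} = {}")
    case True
    then show ?thesis by (simp only: card.empty)
  next
    case False
    then obtain d where d: "d \<in> C" "d + y \<in> K" by auto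
    have "d + c \<in> K - B" if "c \<in> C" "c + y \<in> K" for c
    proof -
      have "d + c \<in> K"
        using K_add[OF d(2) that(2)] by (simp add: ac_simps)
      moreover have "d + c \<notin> B"
        using assms(4) set_plus_intro[of "d + c" B d C] d(1) that(1) by (auto simp: ac_simps)
      ultimately show ?thesis by blast
    qed
    then have "card ((+) d ` {c \<in> C. c + y \<in> K}) \<le> card (K - B)"
      by (intro card_mono) auto
    then show ?thesis using \<open>B \<subseteq> K\<close> by (simp add: card_translate card_Diff_subset)
  qed
  have "card K * card C = (\<Sum>c\<in>C. card {y \<in> - K. c + y \<in> K})"
    using fibre by simp
  also have "\<dots> = (\<Sum>y\<in>- K. card {c \<in> C. c + y \<in> K})"
    by (intro sum_multicount_gen[symmetric]) auto
  also have "\<dots> \<le> card (- K) * (card K - card B)"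
    using sum_bounded_above[of "- K", OF coset] by simp
  finally show ?thesis by (simp add: Compl_eq_Diff_UNIV card_Diff_subset)
qed

lemma card_translate_Diff_add_le:
  fixes B C :: "'a::{boolean_group, finite} set"
  assumes "B \<inter> C = {}" "(B + C) \<inter> (B \<union> C) = {}" "b \<in> B"
  shows "card ((+) b ` B - B) + card B + 2 * card C \<le> CARD('a)"
proof -
  have sum_BC: "x + y \<notin> B \<union> C" if "x \<in> B" "y \<in> C" for x y
    using assms(2) that by auto
  define L where "L = (+) b ` B - B"
  have "B \<inter> L = {}" by (auto simp: L_def)
  moreover have "(B \<union> L) \<inter> C = {}"
    using sum_BC[OF \<open>b \<in> B\<close>] assms(1) by (fastforce simp: L_def)
  moreover have "(B \<union> L \<union> C) \<inter> (+) b ` C = {}"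
    using sum_BC[OF \<open>b \<in> B\<close>] assms(1) by (auto simp: L_def)
  ultimately have "card L + card B + 2 * card C = card (B \<union> L \<union> C \<union> (+) b ` C)"
    by (simp add: card_Un_disjoint card_translate)
  also have "\<dots> \<le> CARD('a)" by (intro card_mono) auto
  finally show ?thesis by (simp add: L_def)
qed

lemma coset_bound_imp_density_le:
  fixes n k b c :: real
  assumes "0 < n" "2 * k \<le> n" "b + 2 * c \<le> n" and coset_bound: "k * c \<le> (n - k) * (k - b)"
  shows "5 * (b + c) \<le> 3 * n"
proof (rule ccontr)
  assume "\<not> ?thesis"
  then have "3 * n * (2 * n - 3 * k) < 5 * (b + c) * (2 * n - 3 * k)"
    using assms(1,2) by (intro mult_strict_right_mono) auto
  moreover have "(2 * (b + c) - n) * (n - 2 * k) \<le> b * (n - 2 * k)"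
    using assms(2,3) by (intro mult_right_mono) auto
  with coset_bound have "(b + c) * (2 * n - 3 * k) \<le> n * n - n * k - k * k"
    by (simp add: algebra_simps)
  ultimately have "(n - 2 * k)\<^sup>2 + k\<^sup>2 < 0"
    by (simp add: power2_eq_square algebra_simps)
  then show False using not_sum_power2_lt_zero by blast
qed

text \<open>
  Unless the bound holds, the smaller class \<open>B\<close> is almost closed under addition, which makes
  \<open>K = B + B\<close> a subgroup containing \<open>B\<close>.  It misses \<open>C\<close>, and \<open>C\<close> loses a translate of \<open>B\<close> in every
  coset of \<open>K\<close> that it meets.
\<close>

lemma card_cross_sum_avoiding_le:
  fixes B C :: "'a::{boolean_group, finite} set"
  assumes "B \<inter> C = {}" "(B + C) \<inter> (B \<union> C) = {}" "B \<noteq> {}" "C \<noteq> {}"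
  shows "5 * (card B + card C) \<le> 3 * CARD('a)"
  using assms
proof (induction "card B" "card C" arbitrary: B C rule: linorder_wlog)
  case (le B C)
  obtain b c where bc: "b \<in> B" "c \<in> C" using le.prems by blast
  note translate_bound = card_translate_Diff_add_le[OF le.prems(1,2)]
  show ?case
  proof (rule ccontr)
    assume large: "\<not> ?case"
    define K where "K = B + B"
    have "3 * card ((+) b ` B - B) < card B" if "b \<in> B" for b
      using translate_bound[OF that] le.hyps large by simp
    then have "B + B + B \<subseteq> B + B"
      by (intro almost_closed_imp_triple_sums) auto
    then have subgroup: "K + K \<subseteq> K" and "B \<subseteq> K"
      unfolding K_def by (rule triple_sums_imp_subgroup)+
    have "x + y \<notin> C" if "x \<in> B" "y \<in> B" for x y
      using le.prems(2) set_plus_intro[of x B "x + y" C] that by auto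
    then have "K \<inter> C = {}" by (auto simp: K_def elim!: set_plus_elim)
    then have "2 * card K \<le> CARD('a)"
      using two_mult_card_subgroup_le[OF subgroup] bc(2) by blast
    moreover have "card K * card C \<le> (CARD('a) - card K) * (card K - card B)"
      using le.prems(2) \<open>B \<subseteq> K\<close> \<open>K \<inter> C = {}\<close> subgroup
      by (intro card_disjoint_from_subgroup_le) auto
    then have "real (card K * card C) \<le> real ((CARD('a) - card K) * (card K - card B))"
      by (rule of_nat_mono)
    moreover have "card B \<le> card K" using \<open>B \<subseteq> K\<close> by (simp add: card_mono)
    moreover have "card B + 2 * card C \<le> CARD('a)" using translate_bound[OF bc(1)] by linarith
    ultimately have "5 * (real (card B) + real (card C)) \<le> 3 * real CARD('a)"
      by (intro coset_bound_imp_density_le[of _ "real (card K)"]) auto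
    then have "real (5 * (card B + card C)) \<le> real (3 * CARD('a))" by simp
    then show False using large by (simp only: of_nat_le_iff)
  qed
next
  case (sym B C)
  from sym.prems show ?case
    using sym.hyps[of C B] by (simp add: add.commute Un_commute Int_commute)
qed

section \<open>Overlaps of a set with its translates\<close>

definition overlap :: "'a::plus set \<Rightarrow> 'a \<Rightarrow> 'a set" where
  "overlap S x = {s \<in> S. s + x \<in> S}"

definition distinct_sums :: "'a::plus set \<Rightarrow> 'a set \<Rightarrow> 'a set" where
  "distinct_sums S T = {s + t | s t. s \<in> S \<and> t \<in> T \<and> s \<noteq> t}"

lemma overlap_subset: "overlap S x \<subseteq> S"
  by (auto simp: overlap_def)

lemma overlap_mono: "S \<subseteq> T \<Longrightarrow> overlap S x \<subseteq> overlap T x"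
  by (auto simp: overlap_def)

lemma overlap_0 [simp]: "overlap S 0 = S"
  for S :: "'a::monoid_add set"
  by (simp add: overlap_def)

lemma overlap_eq_Int_translate: "overlap S x = S \<inter> (+) x ` S"
  for S :: "'a::boolean_group set"
  by (simp add: set_eq_iff overlap_def in_translate_iff) (simp add: add.commute)

lemma zero_notin_distinct_sums: "0 \<notin> distinct_sums S T"
  for S :: "'a::boolean_group set"
  by (auto simp: distinct_sums_def eq_commute[of 0])

lemma overlap_eq_empty:
  fixes S :: "'a::boolean_group set"
  assumes "x \<noteq> 0" and "x \<notin> distinct_sums S S"
  shows "overlap S x = {}"
proof -
  have "s + (s + x) \<in> distinct_sums S S" if "s \<in> S" "s + x \<in> S" for s
    using that \<open>x \<noteq> 0\<close> unfolding distinct_sums_def by fastforce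
  then show ?thesis using assms(2) by (auto simp: overlap_def)
qed

lemma sum_card_overlap:
  fixes S :: "'a::{boolean_group, finite} set"
  shows "(\<Sum>x\<in>UNIV. card (overlap S x)) = card S * card S"
proof -
  have "{x. s + x \<in> S} = (+) s ` S" for s
    by (auto simp: in_translate_iff)
  then have "card {x \<in> UNIV. s + x \<in> S} = card S" for s
    by (simp add: card_translate)
  then have "(\<Sum>x\<in>UNIV. card {s \<in> S. s + x \<in> S}) = (\<Sum>s\<in>S. card S)"
    by (intro sum_multicount_gen) auto
  then show ?thesis by (simp add: overlap_def)
qed

lemma sum_card_overlap_le:
  fixes S :: "'a::{boolean_group, finite} set"
  assumes "0 \<notin> Q"
  shows "(\<Sum>x\<in>Q. real (card (overlap S x))) \<le> card S * (real (card S) - 1)"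
proof -
  have "(\<Sum>x\<in>Q. card (overlap S x)) + card S = (\<Sum>x\<in>insert 0 Q. card (overlap S x))"
    using assms by simp
  also have "\<dots> \<le> (\<Sum>x\<in>UNIV. card (overlap S x))"
    by (intro sum_mono2) auto
  finally have "real ((\<Sum>x\<in>Q. card (overlap S x)) + card S) \<le> real (card S * card S)"
    unfolding sum_card_overlap by (rule of_nat_mono)
  then show ?thesis by (simp add: algebra_simps)
qed

lemma sum_card_overlap_distinct_sums:
  fixes S :: "'a::{boolean_group, finite} set"
  shows "(\<Sum>x\<in>distinct_sums S S. real (card (overlap S x))) = card S * (real (card S) - 1)"
proof -
  have "(\<Sum>x\<in>UNIV. card (overlap S x)) = (\<Sum>x\<in>insert 0 (distinct_sums S S). card (overlap S x))"
    by (intro sum.mono_neutral_right) (auto simp: overlap_eq_empty)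
  then have "real (card S * card S) = real ((\<Sum>x\<in>distinct_sums S S. card (overlap S x)) + card S)"
    by (simp add: sum_card_overlap zero_notin_distinct_sums)
  then show ?thesis by (simp add: algebra_simps)
qed

lemma card_two_translates:
  fixes S :: "'a::boolean_group set"
  shows "card {x. x + s \<in> S \<and> x + t \<in> S} = card (overlap S (s + t))"
proof -
  have "{x. x + s \<in> S \<and> x + t \<in> S} = (+) s ` overlap S (s + t)"
    by (simp add: set_eq_iff in_translate_iff overlap_def) (simp add: ac_simps)
  then show ?thesis by (simp add: card_translate)
qed

lemma card_Un_translate_add_card_overlap:
  fixes S :: "'a::boolean_group set"
  assumes "finite S"
  shows "card (S \<union> (+) x ` S) + card (overlap S x) = 2 * card S"
  using card_Un_Int[of S "(+) x ` S"] assms by (simp add: overlap_eq_Int_translate card_translate)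

text \<open>
  A coset of \<open>{0, u, v, u + v}\<close> containing \<open>k\<close> elements of \<open>B\<close> satisfies \<open>k \<le> 1 + (k choose 2)\<close>, and
  \<open>k = 0\<close> if it lies in \<open>D\<close>.
\<close>

lemma four_card_le_overlaps:
  fixes B D :: "'a::{boolean_group, finite} set"
  assumes disjoint: "B \<inter> D = {}"
    and invariant: "\<And>x. x \<in> D \<Longrightarrow> x + u \<in> D" "\<And>x. x \<in> D \<Longrightarrow> x + v \<in> D"
  shows "4 * card B + card D \<le> CARD('a)
    + 2 * (card (overlap B u) + card (overlap B v) + card (overlap B (u + v)))"
proof -
  define p where "p = u + v"
  have p: "u + p = v" "v + p = u" by (simp_all add: p_def ac_simps)
  have single: "(\<Sum>x\<in>UNIV. of_bool (x + t \<in> B)) = card B" for t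
    using card_two_translates[of t B t] by simp
  have double: "(\<Sum>x\<in>UNIV. of_bool (x + s \<in> B \<and> x + t \<in> B)) = card (overlap B (s + t))" for s t
    using card_two_translates[of s B t] by simp
  have outside: "x \<notin> B \<and> x + u \<notin> B \<and> x + v \<notin> B \<and> x + p \<notin> B" if "x \<in> D" for x
    using disjoint invariant[OF that] invariant(2)[OF invariant(1)[OF that]] that
    by (auto simp: p_def add.assoc)
  have "(\<Sum>x\<in>UNIV. of_bool (x + 0 \<in> B) + of_bool (x + u \<in> B) + of_bool (x + v \<in> B) + of_bool (x + p \<in> B)
      + of_bool (x \<in> D))
    \<le> (\<Sum>x\<in>UNIV. 1 + of_bool (x + 0 \<in> B \<and> x + u \<in> B) + of_bool (x + v \<in> B \<and> x + p \<in> B)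
      + of_bool (x + 0 \<in> B \<and> x + v \<in> B) + of_bool (x + u \<in> B \<and> x + p \<in> B)
      + of_bool (x + 0 \<in> B \<and> x + p \<in> B) + of_bool (x + u \<in> B \<and> x + v \<in> B) :: nat)"
    using outside by (intro sum_mono) auto
  then show ?thesis
    unfolding sum.distrib single double by (simp add: p flip: p_def)
qed

section \<open>The graph of unique sums\<close>

locale sum_graph =
  fixes A :: "'a::boolean_group set"
begin

definition adj :: "'a \<Rightarrow> 'a \<Rightarrow> bool" where
  "adj a b \<longleftrightarrow> a \<noteq> b \<and> overlap A (a + b) = {a, b}"

definition nbrs :: "'a \<Rightarrow> 'a set" where
  "nbrs a = {b. adj a b}"

definition deg :: "'a \<Rightarrow> nat" where
  "deg a = card (nbrs a)"

definition arcs :: "('a \<times> 'a) set" where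
  "arcs = {(a, b). adj a b}"

definition usums :: "'a set" where
  "usums = {a + b | a b. adj a b}"

definition universal :: "'a \<Rightarrow> bool" where
  "universal g \<longleftrightarrow> g \<in> A \<and> (\<forall>x\<in>A - {g}. adj g x)"

lemma adjI:
  assumes "a \<in> A" "b \<in> A" "a \<noteq> b" "\<And>c d. c \<in> A \<Longrightarrow> d \<in> A \<Longrightarrow> c + d = a + b \<Longrightarrow> c = a \<or> c = b"
  shows "adj a b"
  using assms(1-3) assms(4)[of _ "_ + (a + b)"] by (auto simp: adj_def overlap_def ac_simps)

lemma adjD:
  assumes "adj a b"
  shows "a \<in> A" "b \<in> A" "a \<noteq> b"
  using assms overlap_subset[of A "a + b"] by (auto simp: adj_def)

lemma adj_sym: "adj a b \<Longrightarrow> adj b a"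
  by (auto simp: adj_def add.commute)

lemma adj_unique:
  assumes "adj a b" "c \<in> A" "d \<in> A" "c + d = a + b"
  shows "c = a \<and> d = b \<or> c = b \<and> d = a"
proof -
  have "c + (a + b) \<in> A" using assms(3) by (simp flip: assms(4))
  then have "c \<in> overlap A (a + b)" using assms(2) by (simp add: overlap_def)
  then have "c = a \<or> c = b" using assms(1) by (simp add: adj_def)
  then show ?thesis using assms(4) by (auto simp: add.commute)
qed

lemma adj_in_usums: "adj a b \<Longrightarrow> a + b \<in> usums"
  by (auto simp: usums_def)

lemma adj_of_sum_in_usums:
  assumes "a \<in> A" "b \<in> A" "a + b \<in> usums"
  shows "adj a b"
proof -
  obtain c d where "adj c d" "a + b = c + d"
    using assms(3) by (auto simp: usums_def)
  then show ?thesis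
    using adj_unique[of c d a b] assms(1,2) adj_sym by blast
qed

lemma nbrs_eq_Int_translate: "a \<in> A \<Longrightarrow> nbrs a = A \<inter> (+) a ` usums"
  by (auto simp: nbrs_def in_translate_iff adj_in_usums intro: adj_of_sum_in_usums dest: adjD)

lemma card_overlap_usum:
  assumes "x \<in> usums"
  shows "card (overlap A x) = 2"
proof -
  obtain a b where "adj a b" "x = a + b" using assms by (auto simp: usums_def)
  then show ?thesis by (simp add: adj_def)
qed

end

lemma sum_freeD: "sum_free S \<Longrightarrow> s \<in> S \<Longrightarrow> t \<in> S \<Longrightarrow> s + t \<notin> S"
  by (auto simp: sum_free_def)

lemma sum_reciprocals_le:
  fixes x y s :: real
  assumes "1 \<le> x" "1 \<le> y" "s \<le> x + y" "1 < s"
  shows "1 / x + 1 / y \<le> s / (s - 1)"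
proof -
  have "0 \<le> (x - 1) * (y - 1)" using assms by simp
  then have "(x + y - 1) * s \<le> x * y * s"
    using assms by (intro mult_right_mono) (auto simp: algebra_simps)
  then have "(x + y) * (s - 1) \<le> s * (x * y)" using assms by (simp add: algebra_simps)
  then show ?thesis using assms by (simp add: field_simps)
qed

locale finite_sum_graph = sum_graph A for A :: "'a::{boolean_group, finite} set"
begin

lemma four_card_le_overlap_of_usums:
  assumes "u \<in> usums" "v \<in> usums"
  shows "4 * card A \<le> CARD('a) + 2 * card (overlap A (u + v)) + 8"
  using four_card_le_overlaps[of A "{}" u v] assms by (simp add: card_overlap_usum)

lemma sum_free_usums:
  assumes "CARD('a) + 12 < 4 * card A"
  shows "sum_free usums"
proof -
  have "u + v \<notin> usums" if "u \<in> usums" "v \<in> usums" for u v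
    using four_card_le_overlap_of_usums[OF that] card_overlap_usum[of "u + v"] assms by auto
  then show ?thesis by (auto simp: sum_free_def elim!: set_plus_elim)
qed

lemma disjoint_translates_usums:
  assumes "sum_free usums" "adj a b"
  shows "(+) a ` usums \<inter> (+) b ` usums = {}"
proof -
  have "b + x \<notin> usums" if "a + x \<in> usums" for x
  proof
    assume "b + x \<in> usums"
    then have "(a + x) + (b + x) \<notin> usums" using sum_freeD[OF assms(1) that] by blast
    moreover have "(a + x) + (b + x) = a + b" by (simp add: ac_simps)
    ultimately show False using adj_in_usums[OF assms(2)] by simp
  qed
  then show ?thesis by (simp add: disjoint_iff in_translate_iff)
qed

lemma card_add_card_usums_le:
  assumes "sum_free usums" "adj a b"
  shows "2 * (card A + card usums) \<le> CARD('a) + 2 * (deg a + deg b)"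
proof -
  note ab = adjD[OF \<open>adj a b\<close>]
  define w A\<^sub>2 U\<^sub>2 N where "w = a + b" and "A\<^sub>2 = A \<union> (+) w ` A"
    and "U\<^sub>2 = (+) a ` usums \<union> (+) b ` usums" and "N = nbrs a \<union> nbrs b"
  have card_A\<^sub>2: "card A\<^sub>2 + 2 = 2 * card A"
    using card_Un_translate_add_card_overlap[of A w] \<open>adj a b\<close> by (simp add: A\<^sub>2_def w_def adj_def)
  have card_U\<^sub>2: "card U\<^sub>2 = 2 * card usums"
    using disjoint_translates_usums[OF assms] by (simp add: U\<^sub>2_def card_Un_disjoint card_translate)
  have in_N: "x \<in> N" if "x \<in> A" "x \<in> U\<^sub>2" for x
    using that unfolding N_def U\<^sub>2_def nbrs_eq_Int_translate[OF ab(1)] nbrs_eq_Int_translate[OF ab(2)]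
    by blast
  have "w + x \<in> U\<^sub>2" if "x \<in> U\<^sub>2" for x
    using that by (auto simp: U\<^sub>2_def w_def in_translate_iff ac_simps)
  then have "x \<in> N \<union> (+) w ` N" if "x \<in> A\<^sub>2 \<inter> U\<^sub>2" for x
    using in_N[of x] in_N[of "w + x"] that unfolding A\<^sub>2_def Un_iff Int_iff in_translate_iff by blast
  then have "A\<^sub>2 \<inter> U\<^sub>2 \<subseteq> N \<union> (+) w ` N" by blast
  then have "card (A\<^sub>2 \<inter> U\<^sub>2) \<le> card (N \<union> (+) w ` N)"
    by (intro card_mono) auto
  moreover have "card (N \<union> (+) w ` N) + 2 \<le> 2 * (deg a + deg b)"
  proof -
    have "{a, b} \<subseteq> overlap N w"
      using \<open>adj a b\<close> adj_sym[OF \<open>adj a b\<close>] by (auto simp: overlap_def N_def nbrs_def w_def ac_simps)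
    then have "card {a, b} \<le> card (overlap N w)" by (intro card_mono) auto
    then have "card (N \<union> (+) w ` N) + 2 \<le> 2 * card N"
      using card_Un_translate_add_card_overlap[of N w] ab(3) by simp
    also have "card N \<le> deg a + deg b" unfolding N_def deg_def by (rule card_Un_le)
    finally show ?thesis by simp
  qed
  moreover have "card A\<^sub>2 + card U\<^sub>2 \<le> CARD('a) + card (A\<^sub>2 \<inter> U\<^sub>2)"
    using card_Un_Int[of A\<^sub>2 U\<^sub>2] card_mono[of UNIV "A\<^sub>2 \<union> U\<^sub>2"] by simp
  ultimately show ?thesis using card_A\<^sub>2 card_U\<^sub>2 by simp
qed

lemma card_Int_edge_translates_le:
  assumes "adj a b" "H \<subseteq> usums"
  shows "card (A \<inter> ((+) a ` H \<union> (+) b ` H)) \<le> deg a + deg b"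
proof -
  have "A \<inter> ((+) a ` H \<union> (+) b ` H) \<subseteq> nbrs a \<union> nbrs b"
    using assms adjD[OF assms(1)] by (auto simp: nbrs_eq_Int_translate)
  then have "card (A \<inter> ((+) a ` H \<union> (+) b ` H)) \<le> card (nbrs a \<union> nbrs b)"
    by (intro card_mono) auto
  also have "\<dots> \<le> deg a + deg b" unfolding deg_def by (rule card_Un_le)
  finally show ?thesis .
qed

text \<open>
  Four-point counting in the cosets of \<open>{0, a + b, v, a + b + v}\<close>.  The cosets that make up \<open>D\<close> lie in
  the union of \<open>a + usums\<close> and \<open>b + usums\<close>, where \<open>A\<close> has only few elements.
\<close>

lemma four_card_le_overlap_of_edge:
  assumes "sum_free usums" "adj a b" "v \<in> usums"
  shows "4 * card A + 2 * card (overlap usums (a + b + v))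
    \<le> CARD('a) + 2 * card (overlap A (a + b + v)) + 4 + 4 * (deg a + deg b)"
proof -
  define w p where "w = a + b" and "p = w + v"
  define H where "H = overlap usums p"
  define D where "D = (+) a ` H \<union> (+) b ` H"
  have in_D_iff: "x \<in> D \<longleftrightarrow> a + x \<in> H \<or> b + x \<in> H" for x
    by (simp add: D_def in_translate_iff)
  have H_p: "x + p \<in> H" if "x \<in> H" for x
    using that by (auto simp: H_def overlap_def add.assoc)
  have D_w: "x + w \<in> D" if "x \<in> D" for x
    using that by (auto simp: in_D_iff w_def ac_simps)
  have D_p: "x + p \<in> D" if "x \<in> D" for x
    using that H_p by (auto simp: in_D_iff simp flip: add.assoc)
  have D_v: "x + v \<in> D" if "x \<in> D" for x
    using D_w[OF D_p[OF that]] by (simp add: p_def ac_simps)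
  have "H \<subseteq> usums" by (simp add: H_def overlap_subset)
  then have "(+) a ` H \<inter> (+) b ` H = {}"
    using disjoint_translates_usums[OF assms(1,2)] by blast
  then have card_D: "card D = 2 * card H"
    by (simp add: D_def card_Un_disjoint card_translate)
  have card_A: "card A \<le> card (A - D) + (deg a + deg b)"
    using card_Int_edge_translates_le[OF \<open>adj a b\<close> \<open>H \<subseteq> usums\<close>] card_Int_Diff[of A D]
    by (simp add: D_def)
  have "w \<in> H"
    using adj_in_usums[OF assms(2)] \<open>v \<in> usums\<close> by (simp add: H_def overlap_def p_def w_def)
  then have "{a, b} \<subseteq> D" by (auto simp: in_D_iff w_def ac_simps)
  then have overlap_w: "overlap (A - D) w = {}"
    using \<open>adj a b\<close> by (auto simp: adj_def overlap_def w_def)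
  have overlap_v: "card (overlap (A - D) v) \<le> 2"
    using card_mono[OF finite overlap_mono[of "A - D" A v]] card_overlap_usum[OF \<open>v \<in> usums\<close>] by auto
  have overlap_p: "card (overlap (A - D) p) \<le> card (overlap A p)"
    by (intro card_mono overlap_mono) auto
  have "4 * card (A - D) + card D
      \<le> CARD('a) + 2 * (card (overlap (A - D) w) + card (overlap (A - D) v) + card (overlap (A - D) p))"
    unfolding p_def using D_w D_v by (intro four_card_le_overlaps) auto
  then show ?thesis
    using card_A card_D overlap_v overlap_p unfolding overlap_w by (simp add: H_def p_def w_def)
qed

lemma card_arcs_with_sum_in:
  assumes "S \<subseteq> usums"
  shows "card {p \<in> arcs. fst p + snd p \<in> S} = 2 * card S"
proof -
  have fibre: "card {p \<in> arcs. fst p + snd p = u} = 2" if "u \<in> S" for u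
  proof -
    obtain a b where ab: "adj a b" "u = a + b"
      using assms \<open>u \<in> S\<close> by (auto simp: usums_def)
    have ends: "c = a \<and> d = b \<or> c = b \<and> d = a" if "adj c d" "c + d = u" for c d
      using adj_unique[OF ab(1) adjD(1,2)[OF that(1)]] that(2) ab(2) by simp
    have "{p \<in> arcs. fst p + snd p = u} = {(a, b), (b, a)}"
    proof
      show "{p \<in> arcs. fst p + snd p = u} \<subseteq> {(a, b), (b, a)}"
        by (auto simp: arcs_def dest!: ends)
      show "{(a, b), (b, a)} \<subseteq> {p \<in> arcs. fst p + snd p = u}"
        using ab adj_sym[OF ab(1)] by (auto simp: arcs_def add.commute)
    qed
    then show ?thesis using adjD(3)[OF ab(1)] by simp
  qed
  have "{p \<in> arcs. fst p + snd p \<in> S} = (\<Union>u\<in>S. {p \<in> arcs. fst p + snd p = u})"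
    by auto
  also have "card \<dots> = (\<Sum>u\<in>S. card {p \<in> arcs. fst p + snd p = u})"
    by (intro card_UN_disjoint) auto
  finally show ?thesis by (simp add: fibre)
qed

lemma card_arcs: "card arcs = 2 * card usums"
proof -
  have "{p \<in> arcs. fst p + snd p \<in> usums} = arcs"
    by (auto simp: arcs_def adj_in_usums)
  then show ?thesis using card_arcs_with_sum_in[of usums] by simp
qed

lemma arcs_eq_Sigma: "arcs = Sigma A nbrs"
  by (auto simp: arcs_def nbrs_def dest: adjD)

lemma sum_deg: "(\<Sum>a\<in>A. deg a) = 2 * card usums"
  using card_arcs by (simp add: arcs_eq_Sigma deg_def)

lemma sum_arcs:
  fixes f :: "'a \<Rightarrow> real"
  shows "(\<Sum>(a, b)\<in>arcs. f a + f b) = 2 * (\<Sum>a\<in>A. deg a * f a)"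
proof -
  have "(\<Sum>(a, b)\<in>arcs. f b) = (\<Sum>(a, b)\<in>arcs. f a)"
    by (rule sum.reindex_bij_witness[of _ prod.swap prod.swap]) (auto simp: arcs_def dest: adj_sym)
  moreover have "(\<Sum>(a, b)\<in>arcs. f a) = (\<Sum>a\<in>A. deg a * f a)"
    unfolding arcs_eq_Sigma by (subst sum.Sigma[symmetric]) (auto simp: deg_def)
  ultimately show ?thesis by (simp add: case_prod_unfold sum.distrib)
qed

lemma sum_deg_le_card_usums:
  "2 * (\<Sum>x\<in>X. deg x) \<le> 2 * card usums + (\<Sum>x\<in>X. card (nbrs x \<inter> X))"
proof -
  define out where "out = Sigma X nbrs"
  have "2 * (\<Sum>x\<in>X. deg x) = card out + card (prod.swap ` out)"
    by (simp add: out_def deg_def card_image)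
  also have "\<dots> = card (out \<union> prod.swap ` out) + card (out \<inter> prod.swap ` out)"
    by (intro card_Un_Int) auto
  also have "card (out \<union> prod.swap ` out) \<le> card arcs"
    by (intro card_mono) (auto simp: out_def arcs_def nbrs_def dest: adj_sym)
  also have "out \<inter> prod.swap ` out = (SIGMA x:X. nbrs x \<inter> X)"
    by (auto simp: out_def nbrs_def image_iff dest: adj_sym)
  finally show ?thesis by (simp add: card_arcs)
qed

lemma triangle_free:
  assumes "sum_free usums" "adj a b" "adj b c"
  shows "\<not> adj a c"
proof
  assume "adj a c"
  then have "(a + b) + (b + c) \<in> usums" by (simp add: add.assoc adj_in_usums)
  then show False using sum_freeD[OF assms(1)] assms(2,3) adj_in_usums by blast
qed

lemma card_nbrs_Int_edge_le:
  assumes "sum_free usums" "adj a b"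
  shows "card (nbrs x \<inter> {a, b}) \<le> 1"
proof -
  have "nbrs x \<inter> {a, b} \<subseteq> {a} \<or> nbrs x \<inter> {a, b} \<subseteq> {b}"
    using triangle_free[OF assms(1) _ assms(2), of x] by (auto simp: nbrs_def)
  then show ?thesis
    using card_mono[of "{a}" "nbrs x \<inter> {a, b}"] card_mono[of "{b}" "nbrs x \<inter> {a, b}"] by force
qed

lemma card_le_of_three_disjoint_edges:
  assumes "sum_free usums" and edges: "adj a\<^sub>1 b\<^sub>1" "adj a\<^sub>2 b\<^sub>2" "adj a\<^sub>3 b\<^sub>3"
    and distinct: "distinct [a\<^sub>1, b\<^sub>1, a\<^sub>2, b\<^sub>2, a\<^sub>3, b\<^sub>3]"
  shows "4 * card usums + 6 * card A \<le> 3 * CARD('a) + 18"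
proof -
  define X where "X = {a\<^sub>1, b\<^sub>1, a\<^sub>2, b\<^sub>2, a\<^sub>3, b\<^sub>3}"
  have three: "card (nbrs v \<inter> X) \<le> 3" for v
  proof -
    have "nbrs v \<inter> X = (nbrs v \<inter> {a\<^sub>1, b\<^sub>1}) \<union> (nbrs v \<inter> {a\<^sub>2, b\<^sub>2}) \<union> (nbrs v \<inter> {a\<^sub>3, b\<^sub>3})"
      by (auto simp: X_def)
    also have "card \<dots> \<le> card (nbrs v \<inter> {a\<^sub>1, b\<^sub>1}) + card (nbrs v \<inter> {a\<^sub>2, b\<^sub>2}) + card (nbrs v \<inter> {a\<^sub>3, b\<^sub>3})"
      by (intro order_trans[OF card_Un_le] add_mono card_Un_le order_refl)
    also have "\<dots> \<le> 1 + 1 + 1"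
      by (intro add_mono card_nbrs_Int_edge_le assms(1) edges)
    finally show ?thesis by simp
  qed
  have "2 * (\<Sum>x\<in>X. deg x) \<le> 2 * card usums + (\<Sum>x\<in>X. card (nbrs x \<inter> X))"
    by (rule sum_deg_le_card_usums)
  also have "(\<Sum>x\<in>X. card (nbrs x \<inter> X)) \<le> card X * 3"
    using sum_bounded_above[of X, OF three] by simp
  also have "card X * 3 = 18" using distinct by (simp add: X_def)
  finally have "(\<Sum>x\<in>X. deg x) \<le> card usums + 9" by simp
  moreover have "(\<Sum>x\<in>X. deg x) = (deg a\<^sub>1 + deg b\<^sub>1) + (deg a\<^sub>2 + deg b\<^sub>2) + (deg a\<^sub>3 + deg b\<^sub>3)"
    using distinct by (simp add: X_def)
  ultimately show ?thesis
    using card_add_card_usums_le[OF assms(1) edges(1)] card_add_card_usums_le[OF assms(1) edges(2)]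
      card_add_card_usums_le[OF assms(1) edges(3)] by simp
qed

definition dominating_pair :: "'a \<Rightarrow> 'a \<Rightarrow> bool" where
  "dominating_pair g h \<longleftrightarrow> g \<in> A \<and> h \<in> A \<and> g \<noteq> h \<and> A - {g, h} \<subseteq> nbrs g \<union> nbrs h"

lemma dominating_pair_overlap:
  assumes "dominating_pair g h"
  shows "overlap A (g + h) = {g, h}"
proof -
  have gh: "g \<in> A" "h \<in> A" "g \<noteq> h" using assms by (auto simp: dominating_pair_def)
  have "x + (g + h) \<notin> A" if "x \<in> A - {g, h}" for x
  proof
    assume shifted: "x + (g + h) \<in> A"
    have "adj g x \<or> adj h x"
      using assms that by (auto simp: dominating_pair_def nbrs_def)
    then show False
      using adj_unique[of g x h, OF _ gh(2) shifted] adj_unique[of h x g, OF _ gh(1) shifted] gh(3) that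
      by (auto simp: ac_simps)
  qed
  then show ?thesis using gh by (auto simp: overlap_def ac_simps)
qed

lemma dominating_pair_adj:
  assumes "dominating_pair g h"
  shows "adj g h"
  using dominating_pair_overlap[OF assms] assms by (simp add: adj_def dominating_pair_def)

lemma dominating_pair_inj_on:
  assumes "dominating_pair g h"
  shows "inj_on (\<lambda>(x, b). x + b) ({g, h} \<times> (A - {g, h}))"
proof -
  have no_shift: "g + b \<noteq> h + c" if "b \<in> A - {g, h}" "c \<in> A - {g, h}" for b c
  proof
    assume "g + b = h + c"
    then have "b + (g + h) = c" by (metis add.commute add.left_commute add_self_left)
    then have "b \<in> overlap A (g + h)" using that by (simp add: overlap_def)
    then show False using dominating_pair_overlap[OF assms] that(1) by simp
  qed
  show ?thesis
    using no_shift no_shift[symmetric] by (auto simp: inj_on_def)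
qed

lemma nbrs_cross_sums:
  assumes "B \<subseteq> A - {g, h}" "C \<subseteq> A - {g, h}"
    and "B \<subseteq> nbrs g" "C \<subseteq> nbrs h" "B \<inter> C = {}"
  shows "(({g, h} + B) + ({g, h} + C)) \<inter> ({g, h} + (A - {g, h})) = {}"
proof -
  have no_triple: False if "b \<in> B" "c \<in> C" "e \<in> A - {g, h}" "b + c + e \<in> {g, h}" for b c e
  proof -
    have "c + e = b + (b + c + e)" "b + e = c + (b + c + e)" by (simp_all add: ac_simps)
    then have "c + e = g + b \<or> b + e = h + c" using that(4) by (auto simp: add.commute)
    moreover have "adj g b" "adj h c" using that(1,2) assms(3,4) by (auto simp: nbrs_def)
    ultimately show False
      using adj_unique[of g b c e] adj_unique[of h c b e] that(1-3) assms(1,2,5) by blast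
  qed
  have "s + t \<notin> {g, h} + (A - {g, h})" if "s \<in> {g, h} + B" "t \<in> {g, h} + C" for s t
  proof
    assume "s + t \<in> {g, h} + (A - {g, h})"
    then obtain z e where ze: "s + t = z + e" "z \<in> {g, h}" "e \<in> A - {g, h}" by (rule set_plus_elim)
    obtain x b where xb: "s = x + b" "x \<in> {g, h}" "b \<in> B" using \<open>s \<in> _\<close> by (rule set_plus_elim)
    obtain y c where yc: "t = y + c" "y \<in> {g, h}" "c \<in> C" using \<open>t \<in> _\<close> by (rule set_plus_elim)
    have "b + c + e = x + y + (s + t) + e" by (simp add: xb(1) yc(1) ac_simps)
    also have "\<dots> = x + y + z" unfolding ze(1) by (simp add: ac_simps)
    also have "\<dots> \<in> {g, h}" using xb(2) yc(2) ze(2) by (auto simp: ac_simps)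
    finally show False using no_triple xb(3) yc(3) ze(3) by blast
  qed
  then show ?thesis by (simp only: set_plus_Int_empty_iff) blast
qed

lemma card_le_of_dominating_pair:
  assumes pair: "dominating_pair g h" and no_universal: "\<nexists>x. universal x"
  shows "10 * card A \<le> 3 * CARD('a) + 20"
proof -
  define A' where "A' = A - {g, h}"
  define B C where "B = A' \<inter> nbrs g" and "C = A' - B"
  define V where "V = {g, h}"
  have gh: "g \<in> A" "h \<in> A" "g \<noteq> h" using pair by (auto simp: dominating_pair_def)
  have BC: "B \<subseteq> A'" "C \<subseteq> A'" "B \<inter> C = {}" "B \<union> C = A'"
    and nbrs: "B \<subseteq> nbrs g" "C \<subseteq> nbrs h"
    using pair by (auto simp: B_def C_def A'_def dominating_pair_def)
  have nonempty: "B \<noteq> {}" "C \<noteq> {}"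
    using no_universal nbrs BC(4) gh dominating_pair_adj[OF pair] adj_sym[OF dominating_pair_adj[OF pair]]
    by (fastforce simp: universal_def nbrs_def A'_def)+
  have inj: "inj_on (\<lambda>(x, b). x + b) (V \<times> A')"
    using dominating_pair_inj_on[OF pair] by (simp add: V_def A'_def)
  have card_V: "card (V + X) = 2 * card X" if "X \<subseteq> A'" for X
  proof -
    have "inj_on (\<lambda>(x, b). x + b) (V \<times> X)" using that by (intro inj_on_subset[OF inj]) auto
    then have "card (V + X) = card (V \<times> X)" unfolding set_plus_image by (rule card_image)
    then show ?thesis using gh(3) by (simp add: V_def)
  qed
  have "(V + B) \<inter> (V + C) = (\<lambda>(x, b). x + b) ` (V \<times> B \<inter> V \<times> C)"
    unfolding set_plus_image by (intro inj_on_image_Int[OF inj, symmetric]) (use BC in auto)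
  then have disjoint: "(V + B) \<inter> (V + C) = {}"
    using BC(3) by auto
  have "((V + B) + (V + C)) \<inter> ((V + B) \<union> (V + C)) = {}"
    using nbrs_cross_sums[OF BC(1,2)[unfolded A'_def] nbrs BC(3)] BC(4)
    by (simp add: V_def A'_def flip: set_plus_Un)
  then have "5 * (card (V + B) + card (V + C)) \<le> 3 * CARD('a)"
    using nonempty disjoint by (intro card_cross_sum_avoiding_le) (auto simp: set_plus_def V_def)
  then have "10 * (card B + card C) \<le> 3 * CARD('a)"
    using card_V BC(1,2) by simp
  moreover have "card A = card B + card C + 2"
    using card_Un_disjoint[of B C] card_Diff_subset[of "{g, h}" A] card_mono[of A "{g, h}"] gh BC(3,4)
    by (auto simp: A'_def)
  ultimately show ?thesis by simp
qed

end

section \<open>Graphs without isolated vertices\<close>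

locale nonisolated_sum_graph = finite_sum_graph A for A :: "'a::{boolean_group, finite} set" +
  assumes nonisolated: "a \<in> A \<Longrightarrow> \<exists>b. adj a b"
begin

lemma deg_pos: "a \<in> A \<Longrightarrow> 0 < deg a"
  using nonisolated[of a] by (auto simp: deg_def nbrs_def card_gt_0_iff)

lemma two_disjoint_edges:
  assumes "A \<noteq> {}" and no_universal: "\<nexists>g. universal g"
  obtains a b c d where "adj a b" "adj c d" "distinct [a, b, c, d]"
proof -
  obtain a b where ab: "adj a b" using assms(1) nonisolated by blast
  have edge_avoiding: "\<exists>c d. adj c d \<and> c \<noteq> g \<and> d \<noteq> g \<and> \<not> adj g c" if "g \<in> A" for g
  proof -
    obtain c where "c \<in> A" "c \<noteq> g" "\<not> adj g c"
      using no_universal \<open>g \<in> A\<close> unfolding universal_def by blast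
    moreover from this obtain d where "adj c d" using nonisolated by blast
    ultimately show ?thesis using adj_sym by blast
  qed
  obtain c d where cd: "adj c d" "c \<noteq> a" "d \<noteq> a" "\<not> adj a c"
    using edge_avoiding[OF adjD(1)[OF ab]] by blast
  obtain e f where ef: "adj e f" "e \<noteq> b" "f \<noteq> b" "\<not> adj b e"
    using edge_avoiding[OF adjD(2)[OF ab]] by blast
  have "c \<noteq> b" "e \<noteq> a" using ab adj_sym[OF ab] cd(4) ef(4) by auto
  consider (cd_disjoint) "d \<noteq> b" | (ef_disjoint) "f \<noteq> a" | (both_meet) "d = b" "f = a" by blast
  then show ?thesis
  proof cases
    case cd_disjoint
    then show ?thesis
      using that[OF ab cd(1)] adjD(3)[OF ab] adjD(3)[OF cd(1)] cd \<open>c \<noteq> b\<close> by auto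
  next
    case ef_disjoint
    then show ?thesis
      using that[OF ab ef(1)] adjD(3)[OF ab] adjD(3)[OF ef(1)] ef \<open>e \<noteq> a\<close> by auto
  next
    case both_meet
    then have "c \<noteq> e" using cd(1) ef(4) adj_sym by blast
    then show ?thesis
      using that[OF cd(1) ef(1)] both_meet adjD(3)[OF cd(1)] adjD(3)[OF ef(1)] adjD(3)[OF ab] cd(2) ef(2)
      by auto
  qed
qed

lemma card_le_card_usums_of_deg_sum:
  fixes s :: real
  assumes "1 < s" and edge: "\<And>a b. adj a b \<Longrightarrow> s \<le> real (deg a + deg b)"
  shows "card A * (s - 1) \<le> card usums * s"
proof -
  have "real (deg a) * (1 / deg a) = 1" if "a \<in> A" for a
    using deg_pos[OF that] by simp
  then have "2 * real (card A) = (\<Sum>(a, b)\<in>arcs. 1 / deg a + 1 / deg b)"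
    by (simp add: sum_arcs)
  also have "\<dots> \<le> (\<Sum>(a, b)\<in>arcs. s / (s - 1))"
  proof (intro sum_mono, clarify)
    fix a b assume "(a, b) \<in> arcs"
    then have "adj a b" by (simp add: arcs_def)
    then show "1 / real (deg a) + 1 / real (deg b) \<le> s / (s - 1)"
      using adjD[of a b] edge[of a b] \<open>1 < s\<close>
      by (intro sum_reciprocals_le) (auto simp: Suc_le_eq deg_pos)
  qed
  also have "\<dots> = 2 * card usums * (s / (s - 1))"
    by (simp add: card_arcs)
  finally show ?thesis using \<open>1 < s\<close> by (simp add: field_simps)
qed

definition excess :: real where
  "excess = 2 * real (card usums) - real (card A)"

lemma sum_deg_minus_1: "(\<Sum>a\<in>A. real (deg a) - 1) = excess"
proof -
  have "real (\<Sum>a\<in>A. deg a) = 2 * card usums" by (simp only: sum_deg)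
  then show ?thesis by (simp add: sum_subtractf excess_def)
qed

lemma excess_nonneg: "0 \<le> excess"
  unfolding sum_deg_minus_1[symmetric] by (intro sum_nonneg) (simp add: Suc_le_eq deg_pos)

lemma deg_le_excess: "a \<in> A \<Longrightarrow> real (deg a) \<le> excess + 1"
  using member_le_sum[of a A "\<lambda>a. real (deg a) - 1"] by (simp add: sum_deg_minus_1 Suc_le_eq deg_pos)

text \<open>
  For sums with a summand in \<open>light\<close> the error term of \<open>four_card_le_overlap_of_edge\<close> is small enough;
  \<open>card_heavy_le\<close> shows that the remaining sums are few.
\<close>

definition light :: "'a set" where
  "light = {a + b | a b. adj a b \<and> deg a + deg b \<le> 3}"

definition heavy :: "'a set" where
  "heavy = usums - light"

definition defect :: "'a \<times> 'a \<Rightarrow> real" where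
  "defect p = (1 - 1 / deg (fst p)) + (1 - 1 / deg (snd p))"

lemma sum_defect: "(\<Sum>p\<in>arcs. defect p) = 2 * excess"
proof -
  have "(\<Sum>p\<in>arcs. defect p) = 2 * (\<Sum>a\<in>A. deg a * (1 - 1 / deg a))"
    using sum_arcs[of "\<lambda>a. 1 - 1 / deg a"] by (simp add: defect_def case_prod_unfold)
  also have "(\<Sum>a\<in>A. deg a * (1 - 1 / deg a)) = (\<Sum>a\<in>A. real (deg a) - 1)"
  proof (rule sum.cong)
    fix a assume "a \<in> A"
    then have "deg a \<noteq> 0" using deg_pos[of a] by simp
    then show "deg a * (1 - 1 / deg a) = real (deg a) - 1" by (simp add: field_simps)
  qed simp
  finally show ?thesis by (simp add: sum_deg_minus_1)
qed

lemma defect_ge: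
  assumes "(a, b) \<in> arcs"
  shows "1 - 1 / deg a \<le> defect (a, b)" "1 - 1 / deg b \<le> defect (a, b)" "0 \<le> defect (a, b)"
proof -
  have "1 / real (deg a) \<le> 1" "1 / real (deg b) \<le> 1"
    using assms adjD(1,2)[of a b] by (simp_all add: arcs_def Suc_le_eq deg_pos)
  then show "1 - 1 / deg a \<le> defect (a, b)" "1 - 1 / deg b \<le> defect (a, b)" "0 \<le> defect (a, b)"
    by (simp_all add: defect_def)
qed

lemma defect_heavy:
  assumes "p \<in> arcs" "fst p + snd p \<in> heavy"
  shows "2 / 3 \<le> defect p"
proof -
  obtain a b where p: "p = (a, b)" and "adj a b" using assms(1) by (auto simp: arcs_def)
  then have "\<not> deg a + deg b \<le> 3" using assms(2) by (auto simp: heavy_def light_def)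
  then have "1 / real (deg a) + 1 / real (deg b) \<le> 4 / (4 - 1)"
    using adjD[OF \<open>adj a b\<close>] by (intro sum_reciprocals_le) (auto simp: Suc_le_eq deg_pos)
  then show ?thesis by (simp add: p defect_def)
qed

lemma card_heavy_le:
  assumes "g \<in> A"
  shows "2 * real (card heavy) + real (deg g) \<le> 3 * excess + 3"
proof -
  define G where "G = Pair g ` nbrs g \<union> (\<lambda>a. (a, g)) ` nbrs g"
  define P where "P = {p \<in> arcs. fst p + snd p \<in> heavy}"
  have G_arcs: "G \<subseteq> arcs" by (auto simp: G_def arcs_def nbrs_def dest: adj_sym)
  have P_arcs: "P \<subseteq> arcs" by (auto simp: P_def)
  have "Pair g ` nbrs g \<inter> (\<lambda>a. (a, g)) ` nbrs g = {}"
    by (auto simp: nbrs_def dest: adjD)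
  then have card_G: "card G = 2 * deg g"
    by (simp add: G_def card_Un_disjoint card_image inj_on_def deg_def)
  have card_P: "card P = 2 * card heavy"
    unfolding P_def by (rule card_arcs_with_sum_in) (auto simp: heavy_def)
  have "card G * (1 - 1 / deg g) \<le> (\<Sum>p\<in>G. defect p)"
    using G_arcs by (intro sum_bounded_below) (auto simp: G_def intro: defect_ge)
  moreover have "card G * (1 - 1 / deg g) = 2 * real (deg g) - 2"
    using deg_pos[OF assms] by (simp add: card_G field_simps)
  moreover have "card (P - G) * (2 / 3) \<le> (\<Sum>p\<in>P - G. defect p)"
    by (intro sum_bounded_below defect_heavy) (auto simp: P_def)
  moreover have "2 * real (card heavy) - 2 * real (deg g) \<le> card (P - G)"
    using diff_card_le_card_Diff[of G P] by (simp add: card_P card_G)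
  moreover have "(\<Sum>p\<in>G. defect p) + (\<Sum>p\<in>P - G. defect p) \<le> 2 * excess"
  proof -
    have "(\<Sum>p\<in>G. defect p) + (\<Sum>p\<in>P - G. defect p) = (\<Sum>p\<in>G \<union> (P - G). defect p)"
      by (intro sum.union_disjoint[symmetric]) auto
    also have "\<dots> \<le> (\<Sum>p\<in>arcs. defect p)"
      using G_arcs P_arcs by (intro sum_mono2) (auto intro: defect_ge)
    finally show ?thesis by (simp add: sum_defect)
  qed
  ultimately show ?thesis by argo
qed

definition max_deg :: nat where
  "max_deg = Max (deg ` A)"

lemma deg_le_max_deg: "a \<in> A \<Longrightarrow> deg a \<le> max_deg"
  by (simp add: max_deg_def)

lemma card_heavy_square_le:
  assumes "A \<noteq> {}"
  shows "(real (card heavy))\<^sup>2 + max_deg * excess \<le> (3 * excess + 2)\<^sup>2 / 4 + excess"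
proof -
  have "max_deg \<in> deg ` A" unfolding max_deg_def using assms by (intro Max_in) auto
  then obtain g where g: "g \<in> A" "deg g = max_deg" by auto
  have "1 \<le> real max_deg" using deg_pos[OF g(1)] g(2) by simp
  have "2 * real (card heavy) \<le> 3 * excess + 3 - max_deg"
    using card_heavy_le[OF g(1)] g(2) by simp
  then have "(2 * real (card heavy))\<^sup>2 \<le> (3 * excess + 3 - max_deg)\<^sup>2"
    by (intro power_mono) auto
  moreover have "0 \<le> (real max_deg - 1) * (2 * excess + 5 - max_deg)"
    using \<open>1 \<le> real max_deg\<close> deg_le_excess[OF g(1)] g(2) excess_nonneg
    by (intro mult_nonneg_nonneg) auto
  ultimately have "4 * ((real (card heavy))\<^sup>2 + max_deg * excess) \<le> (3 * excess + 2)\<^sup>2 + 4 * excess"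
    by (simp add: power2_eq_square algebra_simps)
  then show ?thesis by simp
qed

text \<open>
  A cherry is a path \<open>a\<close>, \<open>b\<close>, \<open>a + x\<close>.  The sum of an edge at a vertex of \<open>overlap A x\<close> lies in
  \<open>overlap usums x\<close> only if the edge belongs to a cherry.
\<close>

definition cherries :: "'a \<Rightarrow> nat" where
  "cherries x = (\<Sum>b\<in>A. card (overlap (nbrs b) x))"

lemma overlap_independent:
  assumes "adj c d" "c \<in> overlap A x" "d \<in> overlap A x"
  shows "x = 0 \<or> x \<in> usums"
proof -
  have "(c + x) + (d + x) = c + d" by (simp add: ac_simps)
  then have "c + x = c \<or> c + x = d"
    using adj_unique[OF assms(1), of "c + x" "d + x"] assms(2,3) by (auto simp: overlap_def)
  then have "x = 0 \<or> x = c + d" by auto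
  then show ?thesis using adj_in_usums[OF assms(1)] by blast
qed

lemma inj_on_edge_sums:
  assumes partner: "\<And>a. a \<in> A \<Longrightarrow> adj a (partner a)" and "x \<notin> usums" "x \<noteq> 0"
  shows "inj_on (\<lambda>a. a + partner a) (overlap A x)"
proof (rule inj_onI)
  fix c d assume cd: "c \<in> overlap A x" "d \<in> overlap A x" "c + partner c = d + partner d"
  then have "adj c (partner c)" "d \<in> A" "partner d \<in> A"
    using partner adjD overlap_subset by blast+
  then have "d = c \<or> d = partner c"
    using adj_unique[of c "partner c" d "partner d"] cd(3) by auto
  then show "c = d"
    using overlap_independent[OF \<open>adj c (partner c)\<close> cd(1)] cd(2) assms(2,3) by blast
qed

lemma card_edge_sums_Int_overlap_le:
  assumes partner: "\<And>a. a \<in> A \<Longrightarrow> adj a (partner a)"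
  shows "card ((\<lambda>a. a + partner a) ` overlap A x \<inter> overlap usums x) \<le> cherries x"
proof -
  define C where "C = (SIGMA b:A. overlap (nbrs b) x)"
  have "(\<lambda>a. a + partner a) ` overlap A x \<inter> overlap usums x \<subseteq> (\<lambda>(b, a). a + b) ` C"
  proof clarify
    fix a assume a: "a \<in> overlap A x" "a + partner a \<in> overlap usums x"
    then have "adj a (partner a)" by (simp add: overlap_def partner)
    moreover from this a have "adj (a + x) (partner a)"
      using adjD(2) by (intro adj_of_sum_in_usums) (auto simp: overlap_def ac_simps)
    ultimately have "(partner a, a) \<in> C"
      using adjD(2) by (auto simp: C_def nbrs_def overlap_def adj_sym)
    then show "a + partner a \<in> (\<lambda>(b, a). a + b) ` C" by force
  qed
  then have "card ((\<lambda>a. a + partner a) ` overlap A x \<inter> overlap usums x) \<le> card C"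
    by (intro surj_card_le) auto
  then show ?thesis by (simp add: C_def cherries_def)
qed

lemma card_overlap_add_card_overlap_usums_le:
  assumes "x \<notin> usums" "x \<noteq> 0"
  shows "card (overlap A x) + card (overlap usums x) \<le> card usums + cherries x"
proof -
  obtain partner where partner: "\<And>a. a \<in> A \<Longrightarrow> adj a (partner a)"
    using nonisolated by metis
  define S where "S = (\<lambda>a. a + partner a) ` overlap A x"
  have "card S = card (overlap A x)"
    unfolding S_def using inj_on_edge_sums[OF partner assms] by (rule card_image)
  moreover have "card (S \<inter> overlap usums x) \<le> cherries x"
    unfolding S_def using partner by (rule card_edge_sums_Int_overlap_le)
  moreover have "card (S \<union> overlap usums x) \<le> card usums"
  proof (rule card_mono)
    show "S \<union> overlap usums x \<subseteq> usums"
      using overlap_subset partner adj_in_usums by (fastforce simp: S_def)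
  qed simp
  ultimately show ?thesis using card_Un_Int[of S "overlap usums x"] by simp
qed

lemma sum_cherries_le:
  assumes "0 \<notin> Q"
  shows "(\<Sum>x\<in>Q. real (cherries x)) \<le> max_deg * excess"
proof -
  have "(\<Sum>x\<in>Q. real (card (overlap (nbrs b) x))) \<le> max_deg * (real (deg b) - 1)" if "b \<in> A" for b
  proof -
    have "(\<Sum>x\<in>Q. real (card (overlap (nbrs b) x))) \<le> deg b * (real (deg b) - 1)"
      unfolding deg_def by (rule sum_card_overlap_le[OF assms])
    also have "\<dots> \<le> max_deg * (real (deg b) - 1)"
      using deg_pos[OF that] deg_le_max_deg[OF that] by (intro mult_right_mono) auto
    finally show ?thesis .
  qed
  then have "(\<Sum>b\<in>A. \<Sum>x\<in>Q. real (card (overlap (nbrs b) x))) \<le> (\<Sum>b\<in>A. max_deg * (real (deg b) - 1))"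
    by (rule sum_mono)
  also have "\<dots> = max_deg * excess"
    by (simp add: sum_deg_minus_1 flip: sum_distrib_left)
  also have "(\<Sum>b\<in>A. \<Sum>x\<in>Q. real (card (overlap (nbrs b) x))) = (\<Sum>x\<in>Q. real (cherries x))"
    unfolding cherries_def of_nat_sum by (rule sum.swap)
  finally show ?thesis .
qed

lemma sum_overlap_usums_outside_light_le:
  "(\<Sum>x\<in>distinct_sums usums usums - distinct_sums light usums. real (card (overlap usums x)))
    \<le> (real (card heavy))\<^sup>2"
proof -
  let ?R = "distinct_sums usums usums - distinct_sums light usums"
  have "card (overlap usums x) \<le> card (overlap heavy x)" if x: "x \<in> ?R" for x
  proof (intro card_mono subsetI)
    fix u assume u: "u \<in> overlap usums x"
    have "x \<noteq> 0" using x zero_notin_distinct_sums by blast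
    have not_light: "s \<notin> light" if "s \<in> usums" "s + x \<in> usums" for s
    proof
      assume "s \<in> light"
      then have "s + (s + x) \<in> distinct_sums light usums"
        using that \<open>x \<noteq> 0\<close> unfolding distinct_sums_def by fastforce
      then show False using x by simp
    qed
    then show "u \<in> overlap heavy x"
      using u not_light[of u] not_light[of "u + x"] by (auto simp: overlap_def heavy_def add.assoc)
  qed simp
  then have "(\<Sum>x\<in>?R. card (overlap usums x)) \<le> (\<Sum>x\<in>?R. card (overlap heavy x))"
    by (rule sum_mono)
  also have "\<dots> \<le> (\<Sum>x\<in>UNIV. card (overlap heavy x))"
    by (intro sum_mono2) auto
  finally have "real (\<Sum>x\<in>?R. card (overlap usums x)) \<le> real (card heavy * card heavy)"
    unfolding sum_card_overlap by (rule of_nat_mono)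
  then show ?thesis by (simp add: power2_eq_square)
qed

definition surplus :: real where
  "surplus = 2 * real (card A) - CARD('a) / 2 - 8"

lemma surplus_le_overlap:
  assumes "x \<in> distinct_sums usums usums"
  shows "surplus \<le> card (overlap A x)"
proof -
  obtain u v where "u \<in> usums" "v \<in> usums" "x = u + v"
    using assms by (auto simp: distinct_sums_def)
  then have "real (4 * card A) \<le> real (CARD('a) + 2 * card (overlap A x) + 8)"
    by (intro of_nat_mono) (simp add: four_card_le_overlap_of_usums)
  then show ?thesis by (simp add: surplus_def)
qed

lemma overlap_usums_add_surplus_le_overlap:
  assumes "sum_free usums" "x \<in> distinct_sums light usums"
  shows "card (overlap usums x) + surplus \<le> card (overlap A x)"
proof -
  obtain a b v where x: "x = a + b + v" and "adj a b" "v \<in> usums" and light: "deg a + deg b \<le> 3"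
    using assms(2) by (auto simp: distinct_sums_def light_def)
  have "4 * card A + 2 * card (overlap usums x)
      \<le> CARD('a) + 2 * card (overlap A x) + 4 + 4 * (deg a + deg b)"
    unfolding x using assms(1) \<open>adj a b\<close> \<open>v \<in> usums\<close> by (rule four_card_le_overlap_of_edge)
  also have "\<dots> \<le> CARD('a) + 2 * card (overlap A x) + 16" using light by simp
  finally have "real (4 * card A + 2 * card (overlap usums x)) \<le> real (CARD('a) + 2 * card (overlap A x) + 16)"
    by (rule of_nat_mono)
  then show ?thesis by (simp add: surplus_def)
qed

lemma overlap_balance:
  assumes "sum_free usums" "0 \<le> surplus" "x \<in> distinct_sums usums usums"
  shows "(card usums + surplus) * card (overlap usums x)
    \<le> (card usums - surplus) * card (overlap A x) + surplus * cherries x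
      + card usums * (if x \<in> distinct_sums light usums then 0 else real (card (overlap usums x)))"
proof -
  define f h where "f = real (card (overlap A x))" and "h = real (card (overlap usums x))"
  have "x \<notin> usums"
    using assms(1,3) by (auto simp: distinct_sums_def dest: sum_freeD)
  moreover have "x \<noteq> 0" using assms(3) zero_notin_distinct_sums by blast
  ultimately have "real (card (overlap A x) + card (overlap usums x)) \<le> real (card usums + cherries x)"
    by (intro of_nat_mono card_overlap_add_card_overlap_usums_le)
  then have "f + h - card usums \<le> cherries x" by (simp add: f_def h_def)
  then have "surplus * (f + h - card usums) \<le> surplus * cherries x"
    using assms(2) by (intro mult_left_mono)
  moreover have "card usums * surplus \<le> card usums * f"
    using surplus_le_overlap[OF assms(3)] by (intro mult_left_mono) (auto simp: f_def)
  moreover have "card usums * (h + surplus) \<le> card usums * f" if "x \<in> distinct_sums light usums"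
    using overlap_usums_add_surplus_le_overlap[OF assms(1) that]
    by (intro mult_left_mono) (auto simp: f_def h_def)
  ultimately show ?thesis
    by (cases "x \<in> distinct_sums light usums") (simp_all add: algebra_simps f_def h_def)
qed

lemma sum_overlap_balance:
  assumes "sum_free usums" "0 \<le> surplus" "surplus \<le> card usums"
  shows "(card usums + surplus) * (card usums * (real (card usums) - 1))
    \<le> (card usums - surplus) * (card A * (real (card A) - 1))
      + card usums * ((real (card heavy))\<^sup>2 + max_deg * excess)"
proof -
  define Q S where "Q = distinct_sums usums usums" and "S = distinct_sums light usums"
  have "0 \<notin> Q" by (simp add: Q_def zero_notin_distinct_sums)
  have "(card usums + surplus) * (card usums * (real (card usums) - 1))
      = (\<Sum>x\<in>Q. (card usums + surplus) * card (overlap usums x))"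
    by (simp add: Q_def sum_card_overlap_distinct_sums flip: sum_distrib_left)
  also have "\<dots> \<le> (\<Sum>x\<in>Q. (card usums - surplus) * card (overlap A x) + surplus * cherries x
      + card usums * (if x \<in> S then 0 else real (card (overlap usums x))))"
    unfolding Q_def S_def by (intro sum_mono overlap_balance assms(1,2))
  also have "\<dots> = (card usums - surplus) * (\<Sum>x\<in>Q. real (card (overlap A x)))
      + surplus * (\<Sum>x\<in>Q. real (cherries x)) + card usums * (\<Sum>x\<in>Q - S. real (card (overlap usums x)))"
    by (simp add: sum.distrib sum.If_cases Diff_eq flip: sum_distrib_left)
  also have "\<dots> \<le> (card usums - surplus) * (card A * (real (card A) - 1))
      + card usums * (max_deg * excess) + card usums * (real (card heavy))\<^sup>2"
  proof (intro add_mono mult_mono)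
    show "(\<Sum>x\<in>Q. real (card (overlap A x))) \<le> card A * (real (card A) - 1)"
      by (rule sum_card_overlap_le[OF \<open>0 \<notin> Q\<close>])
    show "(\<Sum>x\<in>Q. real (cherries x)) \<le> max_deg * excess"
      by (rule sum_cherries_le[OF \<open>0 \<notin> Q\<close>])
    show "(\<Sum>x\<in>Q - S. real (card (overlap usums x))) \<le> (real (card heavy))\<^sup>2"
      unfolding Q_def S_def by (rule sum_overlap_usums_outside_light_le)
  qed (use assms(3) in \<open>auto intro: sum_nonneg\<close>)
  finally show ?thesis by (simp add: algebra_simps)
qed

lemma few_sums_inequality:
  assumes "A \<noteq> {}" "sum_free usums" "0 \<le> surplus" "surplus \<le> card usums"
  shows "(card usums + surplus) * (card usums * (real (card usums) - 1))
    \<le> (card usums - surplus) * (card A * (real (card A) - 1))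
      + card usums * ((3 * excess + 2)\<^sup>2 / 4 + excess)"
proof -
  have "card usums * ((real (card heavy))\<^sup>2 + max_deg * excess)
      \<le> card usums * ((3 * excess + 2)\<^sup>2 / 4 + excess)"
    using card_heavy_square_le[OF assms(1)] by (intro mult_left_mono) auto
  then show ?thesis using sum_overlap_balance[OF assms(2-4)] by linarith
qed

end

section \<open>Large graphs without isolated vertices\<close>

text \<open>
  Up to the factor 88 this is the inequality of \<open>few_sums_inequality_fails\<close> for the extreme value
  \<open>\<mu> = (4 * a - 34) / 11\<close>.
\<close>

lemma excess_cubic_bound:
  fixes a t :: real
  assumes "100 \<le> a" "0 \<le> t" "11 * t \<le> 3 * a - 64"
  shows "(58 * a + 266) * t ^ 2 + 88 * t ^ 3
    < 7 * a ^ 3 - 366 * a ^ 2 + 364 * a + (5 * a ^ 2 - 328 * a + 92) * t"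
proof -
  define T where "T = (3 * a - 64) / 11"
  define B where "B = (58 * a + 266) * T + 88 * T ^ 2 - (5 * a ^ 2 - 328 * a + 92)"
  have T: "t \<le> T" "0 \<le> T" using assms by (simp_all add: T_def)
  have B_eq: "11 * B = 191 * a ^ 2 - 2378 * a + 14732"
    by (simp add: B_def T_def power2_eq_square field_simps)
  moreover have "0 \<le> 191 * a ^ 2 - 2378 * a"
    using assms(1) mult_right_mono[of 100 a a] by (simp add: power2_eq_square)
  ultimately have "0 \<le> B" by simp
  have "(58 * a + 266) * t \<le> (58 * a + 266) * T" "t ^ 2 \<le> T ^ 2"
    using T assms(1,2) by (auto intro: mult_left_mono power_mono)
  then have "((58 * a + 266) * t + 88 * t ^ 2 - (5 * a ^ 2 - 328 * a + 92)) * t \<le> B * t"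
    using assms(2) by (intro mult_right_mono) (auto simp: B_def)
  also have "\<dots> \<le> B * T" using \<open>0 \<le> B\<close> T(1) by (rule mult_left_mono[rotated])
  also have "\<dots> < 7 * a ^ 3 - 366 * a ^ 2 + 364 * a"
  proof -
    have "100 * 2472 \<le> a * (274 * a - 24928)"
      using assms(1) by (intro mult_mono) auto
    then have "0 \<le> a * (a * (274 * a - 24928) - 152344)" using assms(1) by simp
    then have "(11 * B) * (3 * a - 64) < 121 * (7 * a ^ 3 - 366 * a ^ 2 + 364 * a)"
      unfolding B_eq by (simp add: algebra_simps power2_eq_square power3_eq_cube)
    then show ?thesis by (simp add: T_def)
  qed
  finally show ?thesis by (simp add: algebra_simps power2_eq_square power3_eq_cube)
qed

lemma few_sums_inequality_fails:
  fixes a w \<mu> :: real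
  defines "t \<equiv> 2 * w - a"
  assumes "100 \<le> a" "0 \<le> t" "11 * t \<le> 3 * a - 64" "4 * a - 34 \<le> 11 * \<mu>"
  shows "(w - \<mu>) * (a * (a - 1)) + w * ((3 * t + 2)\<^sup>2 / 4 + t) < (w + \<mu>) * (w * (w - 1))"
proof -
  define \<nu> where "\<nu> = (4 * a - 34) / 11"
  have \<nu>: "\<nu> \<le> \<mu>" "11 * \<nu> = 4 * a - 34" using assms(5) by (simp_all add: \<nu>_def)
  have "0 \<le> a * (a - 1)" "0 \<le> w * (w - 1)"
    using assms(2,3) by (simp_all add: t_def)
  then have "(w - \<mu>) * (a * (a - 1)) \<le> (w - \<nu>) * (a * (a - 1))"
    "(w + \<nu>) * (w * (w - 1)) \<le> (w + \<mu>) * (w * (w - 1))"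
    using \<nu>(1) by (auto intro: mult_right_mono)
  moreover have "7 * a ^ 3 - 366 * a ^ 2 + 364 * a + (5 * a ^ 2 - 328 * a + 92) * t
      - ((58 * a + 266) * t ^ 2 + 88 * t ^ 3)
    = 8 * ((11 * w + 11 * \<nu>) * (w * (w - 1)) - (11 * w - 11 * \<nu>) * (a * (a - 1))
        - 11 * w * ((3 * t + 2)\<^sup>2 / 4 + t))"
    unfolding \<nu>(2) by (simp add: t_def field_simps power2_eq_square power3_eq_cube)
  ultimately show ?thesis
    using excess_cubic_bound[OF assms(2-4)] by (simp add: algebra_simps)
qed

text \<open>
  For \<open>r \<le> 6\<close> the first three hypotheses are contradictory.  For \<open>r = 7, 8\<close> the polynomial estimate
  behind the general case fails over the reals, but only finitely many integral \<open>a, w\<close> remain.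
\<close>

lemma few_sums_impossible:
  fixes a w r :: nat and \<mu> t :: real
  defines "\<mu> \<equiv> 2 * real a - 2 ^ r / 2 - 8" and "t \<equiv> 2 * real w - real a"
  assumes dense: "11 * 2 ^ r + 108 < 36 * a" and "a \<le> 2 * w" and few: "2 * (a + w) \<le> 2 ^ r + 4"
    and inequality: "(w + \<mu>) * (w * (real w - 1))
      \<le> (w - \<mu>) * (a * (real a - 1)) + w * ((3 * t + 2)\<^sup>2 / 4 + t)"
  shows False
proof -
  consider (small) "r \<in> {0, 1, 2, 3, 4, 5, 6}" | (seven) "r = 7" | (eight) "r = 8" | (large) "9 \<le> r"
    by force
  then show False
  proof cases
    case small
    then show False using dense \<open>a \<le> 2 * w\<close> few by (elim insertE; simp) presburger
  next
    case seven
    then have "a \<in> {43, 44}" "w \<in> {22, 23}" "a + w \<le> 66"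
      using dense few \<open>a \<le> 2 * w\<close> by auto
    then show False
      using inequality by (auto simp: seven \<mu>_def t_def power2_eq_square)
  next
    case eight
    then have "a \<in> {82, 83, 84, 85, 86}" "w \<in> {41, 42, 43, 44, 45, 46, 47, 48}" "a + w \<le> 130"
      using dense few \<open>a \<le> 2 * w\<close> by auto
    then show False
      using inequality \<open>a \<le> 2 * w\<close> by (auto simp: eight \<mu>_def t_def power2_eq_square)
  next
    case large
    have "512 \<le> (2::real) ^ r" using power_increasing[OF large, of "2::real"] by simp
    moreover have "real (11 * 2 ^ r + 108) < real (36 * a)"
      using dense by (simp only: of_nat_less_iff)
    moreover have "real (2 * (a + w)) \<le> real (2 ^ r + 4)" using few by (rule of_nat_mono)
    ultimately show False
      using few_sums_inequality_fails[of "real a" "real w" \<mu>] inequality \<open>a \<le> 2 * w\<close>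
      by (simp add: \<mu>_def t_def)
  qed
qed

locale large_sum_graph = nonisolated_sum_graph A for A :: "'a::{boolean_group, finite} set" +
  fixes r :: nat
  assumes card_group: "CARD('a) = 2 ^ r"
    and large: "11 * CARD('a) + 108 < 36 * card A"
begin

lemma nonempty: "A \<noteq> {}"
  using large by auto

lemma usums_sum_free: "sum_free usums"
  using large by (intro sum_free_usums) simp

lemma few_or_many_sums: "2 * (card A + card usums) \<le> CARD('a) + 4 \<or> card A \<le> card usums + 2"
proof (rule ccontr)
  assume contra: "\<not> ?thesis"
  have "r \<noteq> 0"
    using large card_group card_mono[of UNIV A] by (intro notI) simp
  then have even: "CARD('a) = 2 * 2 ^ (r - 1)"
    by (simp add: card_group flip: power_Suc)
  define a m s where "a = real (card A)" and "m = real CARD('a) / 2"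
    and "s = a + real (card usums) - m"
  have "2 ^ (r - 1) + 3 \<le> card A + card usums" using contra even by auto
  then have "real (2 ^ (r - 1) + 3) \<le> real (card A + card usums)" by (rule of_nat_mono)
  then have "3 \<le> s" by (simp add: s_def a_def m_def even)
  moreover have "s \<le> 2 * a - m - 3" using contra by (simp add: s_def a_def)
  ultimately have "0 \<le> (s - 3) * ((2 * a - m - 3) - s)" by simp
  moreover have "s \<le> real (deg v + deg b)" if "adj v b" for v b
  proof -
    have "real (2 * (card A + card usums)) \<le> real (CARD('a) + 2 * (deg v + deg b))"
      using card_add_card_usums_le[OF usums_sum_free that] by (rule of_nat_mono)
    then show ?thesis by (simp add: s_def a_def m_def)
  qed
  then have "a * (s - 1) \<le> card usums * s"
    unfolding a_def using \<open>3 \<le> s\<close> by (intro card_le_card_usums_of_deg_sum) auto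
  then have "0 \<le> s * s - (2 * a - m) * s + a" by (simp add: s_def algebra_simps)
  ultimately have "0 \<le> a - 3 * (2 * a - m - 3)" by (simp add: algebra_simps)
  then have "real (10 * card A) \<le> real (3 * CARD('a) + 18)" by (simp add: a_def m_def)
  then have "10 * card A \<le> 3 * CARD('a) + 18" by (simp only: of_nat_le_iff)
  then show False using large by simp
qed

lemma many_sums: "card A \<le> card usums + 2"
proof (rule ccontr)
  assume "\<not> ?thesis"
  then have few: "2 * (card A + card usums) \<le> CARD('a) + 4" using few_or_many_sums by blast
  have "card A \<le> 2 * card usums" using excess_nonneg by (simp add: excess_def)
  have "real (2 * (card A + card usums)) \<le> real (CARD('a) + 4)" using few by (rule of_nat_mono)
  moreover have "real (11 * CARD('a) + 108) < real (36 * card A)"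
    using large by (simp only: of_nat_less_iff)
  ultimately have "0 \<le> surplus" "surplus \<le> card usums"
    using excess_nonneg by (simp_all add: surplus_def excess_def)
  then show False
    using few_sums_impossible[of r "card A" "card usums"]
      few_sums_inequality[OF nonempty usums_sum_free] large few \<open>card A \<le> 2 * card usums\<close>
    by (simp add: surplus_def excess_def card_group)
qed

lemma no_three_disjoint_edges:
  assumes "adj a\<^sub>1 b\<^sub>1" "adj a\<^sub>2 b\<^sub>2" "adj a\<^sub>3 b\<^sub>3"
  shows "\<not> distinct [a\<^sub>1, b\<^sub>1, a\<^sub>2, b\<^sub>2, a\<^sub>3, b\<^sub>3]"
proof
  assume "distinct [a\<^sub>1, b\<^sub>1, a\<^sub>2, b\<^sub>2, a\<^sub>3, b\<^sub>3]"
  with usums_sum_free assms have "4 * card usums + 6 * card A \<le> 3 * CARD('a) + 18"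
    by (rule card_le_of_three_disjoint_edges)
  then show False using many_sums large by simp
qed

lemma endpoint_without_outside_nbrs:
  assumes "adj a b" "adj c d" "distinct [a, b, c, d]"
  obtains g h where "{g, h} = {a, b}" "nbrs h \<subseteq> {a, b, c, d}"
proof -
  have "nbrs a \<subseteq> {a, b, c, d} \<or> nbrs b \<subseteq> {a, b, c, d}"
  proof (rule ccontr)
    assume "\<not> ?thesis"
    then obtain x y where x: "adj a x" "x \<notin> {a, b, c, d}" and y: "adj b y" "y \<notin> {a, b, c, d}"
      by (auto simp: nbrs_def)
    have "x \<noteq> y" using triangle_free[OF usums_sum_free assms(1) y(1)] x(1) by blast
    then show False
      using no_three_disjoint_edges[OF x(1) y(1) assms(2)] assms(3) x(2) y(2) by auto
  qed
  then show ?thesis using that[of a b] that[of b a] by blast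
qed

lemma dominating_pair_exists:
  assumes no_universal: "\<nexists>g. universal g"
  obtains g h where "dominating_pair g h"
proof -
  obtain a b c d where edges: "adj a b" "adj c d" and distinct: "distinct [a, b, c, d]"
    using two_disjoint_edges[OF nonempty no_universal] .
  obtain g\<^sub>1 h\<^sub>1 where gh\<^sub>1: "{g\<^sub>1, h\<^sub>1} = {a, b}" "nbrs h\<^sub>1 \<subseteq> {a, b, c, d}"
    using endpoint_without_outside_nbrs[OF edges distinct] .
  obtain g\<^sub>2 h\<^sub>2 where gh\<^sub>2: "{g\<^sub>2, h\<^sub>2} = {c, d}" "nbrs h\<^sub>2 \<subseteq> {c, d, a, b}"
    using endpoint_without_outside_nbrs[OF edges(2,1)] distinct by auto
  have "adj g\<^sub>1 h\<^sub>1" "adj g\<^sub>2 h\<^sub>2"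
    using gh\<^sub>1(1) gh\<^sub>2(1) edges adj_sym[OF edges(1)] adj_sym[OF edges(2)] by (auto simp: doubleton_eq_iff)
  have ends: "{a, b, c, d} = {g\<^sub>1, h\<^sub>1, g\<^sub>2, h\<^sub>2}" using gh\<^sub>1(1) gh\<^sub>2(1) by auto
  have "x \<in> nbrs g\<^sub>1 \<union> nbrs g\<^sub>2" if x: "x \<in> A - {g\<^sub>1, g\<^sub>2}" for x
  proof (cases "x \<in> {a, b, c, d}")
    case True
    then have "x = h\<^sub>1 \<or> x = h\<^sub>2" using ends x by auto
    then show ?thesis using \<open>adj g\<^sub>1 h\<^sub>1\<close> \<open>adj g\<^sub>2 h\<^sub>2\<close> by (auto simp: nbrs_def)
  next
    case False
    obtain y where y: "adj x y" using nonisolated x by blast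
    then have "y \<in> {a, b, c, d}"
      using no_three_disjoint_edges[OF edges y] distinct False adjD(3)[OF y] by auto
    moreover have "y \<noteq> h\<^sub>1" "y \<noteq> h\<^sub>2"
      using gh\<^sub>1(2) gh\<^sub>2(2) False adj_sym[OF y] by (auto simp: nbrs_def)
    ultimately show ?thesis using ends adj_sym[OF y] by (auto simp: nbrs_def)
  qed
  moreover have "g\<^sub>1 \<noteq> g\<^sub>2" using gh\<^sub>1(1) gh\<^sub>2(1) distinct by auto
  ultimately have "dominating_pair g\<^sub>1 g\<^sub>2"
    using adjD(1)[OF \<open>adj g\<^sub>1 h\<^sub>1\<close>] adjD(1)[OF \<open>adj g\<^sub>2 h\<^sub>2\<close>] by (auto simp: dominating_pair_def)
  then show ?thesis using that by blast
qed

lemma universal_exists: "\<exists>g. universal g"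
proof (rule ccontr)
  assume no_universal: "\<not> ?thesis"
  then obtain g h where "dominating_pair g h" using dominating_pair_exists by blast
  then have "10 * card A \<le> 3 * CARD('a) + 20"
    using no_universal by (rule card_le_of_dominating_pair)
  then show False using large by simp
qed

end

section \<open>Round sets\<close>

context sum_graph
begin

lemma round_set_nonisolated:
  assumes "round_set A" "a \<in> A" "A \<noteq> {a}"
  shows "\<exists>b. adj a b"
proof -
  have "A - {a} \<subset> A" using assms(2) by auto
  then have "(A - {a}) + (A - {a}) \<noteq> A + A"
    using assms(1) by (simp add: round_set_def)
  moreover have "(A - {a}) + (A - {a}) \<subseteq> A + A"
    by (intro set_plus_mono2) auto
  ultimately obtain s where s: "s \<in> A + A" "s \<notin> (A - {a}) + (A - {a})" by blast
  have uses_a: "c = a \<or> d = a" if "c \<in> A" "d \<in> A" "c + d = s" for c d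
    using s(2) that set_plus_intro[of c "A - {a}" d "A - {a}"] by blast
  obtain x y where xy: "s = x + y" "x \<in> A" "y \<in> A" using s(1) by (rule set_plus_elim)
  then obtain b where b: "b \<in> A" "s = a + b"
    using uses_a[OF xy(2,3)] by (auto simp: add.commute)
  obtain c where "c \<in> A" "c \<noteq> a" using assms(2,3) by blast
  then have "a \<noteq> b" using uses_a[of c c] b(2) by auto
  moreover have "c = a \<or> c = b" if "c \<in> A" "d \<in> A" "c + d = a + b" for c d
    using uses_a[OF that(1,2)] that(3) b(2) by (auto simp: add.commute)
  ultimately show ?thesis using adjI assms(2) b(1) by blast
qed

lemma universal_imp_translate_of_sum_free:
  assumes "universal g"
  shows "\<exists>S. sum_free S \<and> A = g +o (S \<union> {0})"
proof (intro exI conjI)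
  define S where "S = (+) g ` (A - {g})"
  show "A = g +o (S \<union> {0})"
    using assms by (auto simp: S_def elt_set_plus_def universal_def)
  have "s + t \<notin> S" if "s \<in> S" "t \<in> S" for s t
  proof
    assume "s + t \<in> S"
    then obtain x y z where xyz: "x \<in> A - {g}" "y \<in> A - {g}" "z \<in> A - {g}"
      and "s = g + x" "t = g + y" "s + t = g + z"
      using \<open>s \<in> S\<close> \<open>t \<in> S\<close> unfolding S_def by (elim imageE) blast
    then have "(g + x) + (g + y) = g + z" by simp
    then have "x + y = g + z" by (simp add: ac_simps)
    moreover have "adj g z" using assms xyz(3) by (simp add: universal_def)
    ultimately show False using adj_unique[of g z x y] xyz by blast
  qed
  then show "sum_free S" by (auto simp: sum_free_def elim!: set_plus_elim)
qed

end

lemma CARD_bit: "CARD(bit) = 2"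
proof -
  have "(UNIV :: bit set) = {0, 1}" by (auto intro: bit.exhaust)
  then show ?thesis by (simp only: card_2_iff) auto
qed

theorem theorem3p3:
  fixes A :: "(bit ^ 'r) set"
  assumes "round_set A"
    and "real (card A) > 11 / 36 * 2 ^ CARD('r) + 3"
  shows "\<exists>(S :: (bit ^ 'r) set) (g :: bit ^ 'r). sum_free S \<and> A = g +o (S \<union> {0})"
proof -
  have card_group: "CARD(bit ^ 'r) = 2 ^ CARD('r)" by (simp add: CARD_bit)
  then have "real (11 * CARD(bit ^ 'r) + 108) < real (36 * card A)" using assms(2) by simp
  then have large: "11 * CARD(bit ^ 'r) + 108 < 36 * card A" by (simp only: of_nat_less_iff)
  then have "A \<noteq> {a}" for a by auto
  then interpret large_sum_graph A "CARD('r)"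
    using card_group large sum_graph.round_set_nonisolated[OF assms(1)] by unfold_locales auto
  show ?thesis
    using universal_exists universal_imp_translate_of_sum_free by blast
qed

end
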